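(* Let $x=(x_1,\dots,x_n)$, $f$ a vector of polynomials in $x$, $Q$ a first-order formula of real arithmetic, $\Gamma$ a finite set of formulas, $p$ a polynomial in $x$, $N\geq 1$, and $g_0,\dots,g_{N-1}$ polynomials in $x$. Then the following rule (dRI) is a derived rule of the base dL calculus $\mathcal{C}_0$: from the two premises $\Gamma, Q\vdash \bigwedge_{i=0}^{N-1} L_f^{i}(p)=0$ and $Q\vdash L_f^{N}(p)=\sum_{i=0}^{N-1} g_i\, L_f^{i}(p)$ infer $\Gamma\vdash [x'=f(x)\,\&\,Q]\,p=0$.
   Context: Lie derivatives: $L_f(p)=\sum_i \frac{\partial p}{\partial x_i} f_i$, $L_f^0(p)=p$, $L_f^{i+1}(p)=L_f(L_f^i(p))$. Differential dynamic logic (dL): terms are polynomials with rational coefficients in real variables. Formulas are built from $e_1\sim e_2$ ($\sim\in\{=,\geq,>\}$) with $\neg,\wedge,\vee,\to,\leftrightarrow,\forall,\exists$ and modalities $[\alpha]\phi$, $\langle\alpha\rangle\phi$; modality-free formulas are first-order formulas of real arithmetic. Hybrid programs: $x:=e \mid\, ?\phi \mid x'=f(x)\,\&\,Q \mid \alpha\cup\beta \mid \alpha;\beta \mid \alpha^*$, with polynomial $f$ and first-order real arithmetic $Q$. $(\omega,\nu)$ is a transition of $x'=f(x)\,\&\,Q$ iff there are $T\ge 0$ and a solution $\varphi:[0,T]\to$ states of $x'=f(x)$ (other variables constant) with $\varphi(0)=\omega$, $\varphi(T)=\nu$, and $Q$ true along $\varphi$; other constructs have standard semantics; $[\alpha]\phi$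 holds in $\omega$ iff $\phi$ holds in all $\alpha$-successors, $\langle\alpha\rangle\phi$ iff in some. A sequent $\Gamma\vdash\phi$ means $\bigwedge\Gamma\to\phi$. The base calculus $\mathcal{C}_0$: a classical sequent calculus for first-order logic (cut, weakening, connective rules, real witnesses for $\exists$) in which every valid formula of first-order real arithmetic is an axiom, plus all instances of: $\langle\alpha\rangle\phi\leftrightarrow\neg[\alpha]\neg\phi$; $[x:=e]\phi(x)\leftrightarrow\phi(e)$; $[?\psi]\phi\leftrightarrow(\psi\to\phi)$; $[\alpha\cup\beta]\phi\leftrightarrow[\alpha]\phi\wedge[\beta]\phi$; $[\alpha;\beta]\phi\leftrightarrow[\alpha][\beta]\phi$; $[\alpha^*]\phi\leftrightarrow\phi\wedge[\alpha][\alpha^*]\phi$; (K) $[\alpha](\phi\to\psi)\to([\alpha]\phi\to[\alpha]\psi)$; (I) $[\alpha^*]\phi\leftrightarrow\phi\wedge[\alpha^*](\phi\to[\alpha]\phi)$; (V) $\phi\to[\alpha]\phi$ if no free variable of $\phi$ is changed by $\alpha$; (G) from $\vdash\phi$ infer $\vdash[\alpha]\phi$; (DW) $[x'=f(x)\,\&\,Q]Q$; (DI, with Lie derivatives in place of differential terms) $(Q\to[x'=f(x)\,\&\,Q]L_f(p)\geq0)\to([x'=f(x)\,\&\,Q]p\succcurlyeq0\leftrightarrow(Q\to p\succcurlyeq0))$ for $\succcurlyeq\in\{\geq,>\}$, and the same with $=$; (DMP) $[x'=f(x)\,\&\,Q](Q\to R)\to([x'=f(x)\,\&\,R]\phi\to[x'=f(x)\,\&\,Q]\phi)$;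 (DG) $[x'=f(x)\,\&\,Q]\phi\leftrightarrow\exists y\,[x'=f(x),y'=a(x)y+b(x)\,\&\,Q]\phi$ for a vector $y$ of fresh variables, a matrix $a(x)$ and vector $b(x)$ of polynomials not mentioning $y$; (B$'$) $\langle x'=f(x)\,\&\,Q\rangle\exists y\,\phi\leftrightarrow\exists y\,\langle x'=f(x)\,\&\,Q\rangle\phi$ for $y$ not among $x$. *)

theory Defs
  imports "HOL-Analysis.Analysis"
begin

section \<open>Terms\<close>

type_synonym var = nat
type_synonym state = "var \<Rightarrow> real"

datatype trm =
    Var var
  | Const rat
  | Add trm trm
  | Mult trm trm

primrec term_vars :: "trm \<Rightarrow> var set" where
  "term_vars (Var x) = {x}"
| "term_vars (Const c) = {}"
| "term_vars (Add s t) = term_vars s \<union> term_vars t"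
| "term_vars (Mult s t) = term_vars s \<union> term_vars t"

primrec term_sem :: "trm \<Rightarrow> state \<Rightarrow> real" where
  "term_sem (Var x) \<sigma> = \<sigma> x"
| "term_sem (Const c) \<sigma> = of_rat c"
| "term_sem (Add s t) \<sigma> = term_sem s \<sigma> + term_sem t \<sigma>"
| "term_sem (Mult s t) \<sigma> = term_sem s \<sigma> * term_sem t \<sigma>"

primrec term_subst :: "var \<Rightarrow> trm \<Rightarrow> trm \<Rightarrow> trm" where
  "term_subst x e (Var y) = (if y = x then e else Var y)"
| "term_subst x e (Const c) = Const c"
| "term_subst x e (Add s t) = Add (term_subst x e s) (term_subst x e t)"
| "term_subst x e (Mult s t) = Mult (term_subst x e s) (term_subst x e t)"

fun tsum :: "trm list \<Rightarrow> trm" where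
  "tsum [] = Const 0"
| "tsum [t] = t"
| "tsum (t # ts) = Add t (tsum ts)"

primrec pdiff :: "var \<Rightarrow> trm \<Rightarrow> trm" where
  "pdiff x (Var y) = Const (if y = x then 1 else 0)"
| "pdiff x (Const c) = Const 0"
| "pdiff x (Add s t) = Add (pdiff x s) (pdiff x t)"
| "pdiff x (Mult s t) = Add (Mult (pdiff x s) t) (Mult s (pdiff x t))"

lemma pdiff_correct:
  "((\<lambda>r. term_sem p (\<sigma>(x := r))) has_real_derivative term_sem (pdiff x p) (\<sigma>(x := r))) (at r)"
  by (induction p) (auto intro!: derivative_eq_intros)

text \<open>An ODE system \<open>x' = f(x)\<close> is the list of pairs \<open>(x\<^sub>i, f\<^sub>i)\<close>.\<close>

type_synonym ode = "(var \<times> trm) list"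

abbreviation ode_vars :: "ode \<Rightarrow> var set" where
  "ode_vars ode \<equiv> fst ` set ode"

definition lie :: "ode \<Rightarrow> trm \<Rightarrow> trm" where
  "lie ode p = tsum (map (\<lambda>(x, e). Mult (pdiff x p) e) ode)"


section \<open>Formulas and hybrid programs\<close>

datatype fml =
    Eq trm trm
  | Geq trm trm
  | Gt trm trm
  | Neg fml
  | Conj fml fml
  | Disj fml fml
  | Imp fml fml
  | Iff fml fml
  | Forall var fml
  | Exists var fml
  | Box prog fml
  | Dia prog fml
and prog =
    Assign var trm
  | Test fml
  | ODE ode fml
  | Choice prog prog
  | Compose prog prog
  | Star prog

primrec fo :: "fml \<Rightarrow> bool" where
  "fo (Eq s t) = True"
| "fo (Geq s t) = True"
| "fo (Gt s t) = True"
| "fo (Neg \<phi>) = fo \<phi>"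
| "fo (Conj \<phi> \<psi>) = (fo \<phi> \<and> fo \<psi>)"
| "fo (Disj \<phi> \<psi>) = (fo \<phi> \<and> fo \<psi>)"
| "fo (Imp \<phi> \<psi>) = (fo \<phi> \<and> fo \<psi>)"
| "fo (Iff \<phi> \<psi>) = (fo \<phi> \<and> fo \<psi>)"
| "fo (Forall x \<phi>) = fo \<phi>"
| "fo (Exists x \<phi>) = fo \<phi>"
| "fo (Box \<alpha> \<phi>) = False"
| "fo (Dia \<alpha> \<phi>) = False"

text \<open>The datatypes admit raw expressions outside the language; well-formedness requires the
  left-hand sides of an ODE system to be distinct and its domain constraint to be first-order.\<close>

primrec wf_fml :: "fml \<Rightarrow> bool" and wf_prog :: "prog \<Rightarrow> bool" where
  "wf_fml (Eq s t) = True"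
| "wf_fml (Geq s t) = True"
| "wf_fml (Gt s t) = True"
| "wf_fml (Neg \<phi>) = wf_fml \<phi>"
| "wf_fml (Conj \<phi> \<psi>) = (wf_fml \<phi> \<and> wf_fml \<psi>)"
| "wf_fml (Disj \<phi> \<psi>) = (wf_fml \<phi> \<and> wf_fml \<psi>)"
| "wf_fml (Imp \<phi> \<psi>) = (wf_fml \<phi> \<and> wf_fml \<psi>)"
| "wf_fml (Iff \<phi> \<psi>) = (wf_fml \<phi> \<and> wf_fml \<psi>)"
| "wf_fml (Forall x \<phi>) = wf_fml \<phi>"
| "wf_fml (Exists x \<phi>) = wf_fml \<phi>"
| "wf_fml (Box \<alpha> \<phi>) = (wf_prog \<alpha> \<and> wf_fml \<phi>)"
| "wf_fml (Dia \<alpha> \<phi>) = (wf_prog \<alpha> \<and> wf_fml \<phi>)"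
| "wf_prog (Assign x e) = True"
| "wf_prog (Test \<phi>) = wf_fml \<phi>"
| "wf_prog (ODE ode Q) = (distinct (map fst ode) \<and> fo Q)"
| "wf_prog (Choice \<alpha> \<beta>) = (wf_prog \<alpha> \<and> wf_prog \<beta>)"
| "wf_prog (Compose \<alpha> \<beta>) = (wf_prog \<alpha> \<and> wf_prog \<beta>)"
| "wf_prog (Star \<alpha>) = wf_prog \<alpha>"

fun conjs :: "fml list \<Rightarrow> fml" where
  "conjs [] = Eq (Const 0) (Const 0)"
| "conjs [\<phi>] = \<phi>"
| "conjs (\<phi> # \<phi>s) = Conj \<phi> (conjs \<phi>s)"


section \<open>Semantics\<close>

primrec fml_sem :: "fml \<Rightarrow> state \<Rightarrow> bool" and prog_sem :: "prog \<Rightarrow> (state \<times> state) set" where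
  "fml_sem (Eq s t) \<sigma> = (term_sem s \<sigma> = term_sem t \<sigma>)"
| "fml_sem (Geq s t) \<sigma> = (term_sem s \<sigma> \<ge> term_sem t \<sigma>)"
| "fml_sem (Gt s t) \<sigma> = (term_sem s \<sigma> > term_sem t \<sigma>)"
| "fml_sem (Neg \<phi>) \<sigma> = (\<not> fml_sem \<phi> \<sigma>)"
| "fml_sem (Conj \<phi> \<psi>) \<sigma> = (fml_sem \<phi> \<sigma> \<and> fml_sem \<psi> \<sigma>)"
| "fml_sem (Disj \<phi> \<psi>) \<sigma> = (fml_sem \<phi> \<sigma> \<or> fml_sem \<psi> \<sigma>)"
| "fml_sem (Imp \<phi> \<psi>) \<sigma> = (fml_sem \<phi> \<sigma> \<longrightarrow> fml_sem \<psi> \<sigma>)"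
| "fml_sem (Iff \<phi> \<psi>) \<sigma> = (fml_sem \<phi> \<sigma> \<longleftrightarrow> fml_sem \<psi> \<sigma>)"
| "fml_sem (Forall x \<phi>) \<sigma> = (\<forall>r. fml_sem \<phi> (\<sigma>(x := r)))"
| "fml_sem (Exists x \<phi>) \<sigma> = (\<exists>r. fml_sem \<phi> (\<sigma>(x := r)))"
| "fml_sem (Box \<alpha> \<phi>) \<sigma> = (\<forall>\<nu>. (\<sigma>, \<nu>) \<in> prog_sem \<alpha> \<longrightarrow> fml_sem \<phi> \<nu>)"
| "fml_sem (Dia \<alpha> \<phi>) \<sigma> = (\<exists>\<nu>. (\<sigma>, \<nu>) \<in> prog_sem \<alpha> \<and> fml_sem \<phi> \<nu>)"
| "prog_sem (Assign x e) = {(\<sigma>, \<nu>). \<nu> = \<sigma>(x := term_sem e \<sigma>)}"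
| "prog_sem (Test \<phi>) = {(\<sigma>, \<nu>). \<nu> = \<sigma> \<and> fml_sem \<phi> \<sigma>}"
| "prog_sem (ODE ode Q) =
     {(\<sigma>, \<nu>). \<exists>T \<phi>. T \<ge> 0 \<and> \<phi> 0 = \<sigma> \<and> \<phi> T = \<nu> \<and>
        (\<forall>t\<in>{0..T}.
           (\<forall>(x, e)\<in>set ode.
              ((\<lambda>s. \<phi> s x) has_real_derivative term_sem e (\<phi> t)) (at t within {0..T})) \<and>
           (\<forall>z. z \<notin> ode_vars ode \<longrightarrow> \<phi> t z = \<sigma> z) \<and>
           fml_sem Q (\<phi> t))}"
| "prog_sem (Choice \<alpha> \<beta>) = prog_sem \<alpha> \<union> prog_sem \<beta>"
| "prog_sem (Compose \<alpha> \<beta>) = prog_sem \<alpha> O prog_sem \<beta>"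
| "prog_sem (Star \<alpha>) = (prog_sem \<alpha>)\<^sup>*"

definition valid :: "fml \<Rightarrow> bool" where
  "valid \<phi> \<longleftrightarrow> (\<forall>\<sigma>. fml_sem \<phi> \<sigma>)"


section \<open>Static semantics\<close>

text \<open>Variables that some, respectively every, run of a program writes.\<close>

primrec bound_vars :: "prog \<Rightarrow> var set" where
  "bound_vars (Assign x e) = {x}"
| "bound_vars (Test \<phi>) = {}"
| "bound_vars (ODE ode Q) = ode_vars ode"
| "bound_vars (Choice \<alpha> \<beta>) = bound_vars \<alpha> \<union> bound_vars \<beta>"
| "bound_vars (Compose \<alpha> \<beta>) = bound_vars \<alpha> \<union> bound_vars \<beta>"
| "bound_vars (Star \<alpha>) = bound_vars \<alpha>"

primrec must_bound_vars :: "prog \<Rightarrow> var set" where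
  "must_bound_vars (Assign x e) = {x}"
| "must_bound_vars (Test \<phi>) = {}"
| "must_bound_vars (ODE ode Q) = ode_vars ode"
| "must_bound_vars (Choice \<alpha> \<beta>) = must_bound_vars \<alpha> \<inter> must_bound_vars \<beta>"
| "must_bound_vars (Compose \<alpha> \<beta>) = must_bound_vars \<alpha> \<union> must_bound_vars \<beta>"
| "must_bound_vars (Star \<alpha>) = {}"

primrec free_vars :: "fml \<Rightarrow> var set" and prog_free_vars :: "prog \<Rightarrow> var set" where
  "free_vars (Eq s t) = term_vars s \<union> term_vars t"
| "free_vars (Geq s t) = term_vars s \<union> term_vars t"
| "free_vars (Gt s t) = term_vars s \<union> term_vars t"
| "free_vars (Neg \<phi>) = free_vars \<phi>"
| "free_vars (Conj \<phi> \<psi>) = free_vars \<phi> \<union> free_vars \<psi>"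
| "free_vars (Disj \<phi> \<psi>) = free_vars \<phi> \<union> free_vars \<psi>"
| "free_vars (Imp \<phi> \<psi>) = free_vars \<phi> \<union> free_vars \<psi>"
| "free_vars (Iff \<phi> \<psi>) = free_vars \<phi> \<union> free_vars \<psi>"
| "free_vars (Forall x \<phi>) = free_vars \<phi> - {x}"
| "free_vars (Exists x \<phi>) = free_vars \<phi> - {x}"
| "free_vars (Box \<alpha> \<phi>) = prog_free_vars \<alpha> \<union> (free_vars \<phi> - must_bound_vars \<alpha>)"
| "free_vars (Dia \<alpha> \<phi>) = prog_free_vars \<alpha> \<union> (free_vars \<phi> - must_bound_vars \<alpha>)"
| "prog_free_vars (Assign x e) = term_vars e"
| "prog_free_vars (Test \<phi>) = free_vars \<phi>"
| "prog_free_vars (ODE ode Q) = ode_vars ode \<union> (\<Union>(x, e)\<in>set ode. term_vars e) \<union> free_vars Q"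
| "prog_free_vars (Choice \<alpha> \<beta>) = prog_free_vars \<alpha> \<union> prog_free_vars \<beta>"
| "prog_free_vars (Compose \<alpha> \<beta>) =
     prog_free_vars \<alpha> \<union> (prog_free_vars \<beta> - must_bound_vars \<alpha>)"
| "prog_free_vars (Star \<alpha>) = prog_free_vars \<alpha>"

primrec all_vars :: "fml \<Rightarrow> var set" and prog_all_vars :: "prog \<Rightarrow> var set" where
  "all_vars (Eq s t) = term_vars s \<union> term_vars t"
| "all_vars (Geq s t) = term_vars s \<union> term_vars t"
| "all_vars (Gt s t) = term_vars s \<union> term_vars t"
| "all_vars (Neg \<phi>) = all_vars \<phi>"
| "all_vars (Conj \<phi> \<psi>) = all_vars \<phi> \<union> all_vars \<psi>"
| "all_vars (Disj \<phi> \<psi>) = all_vars \<phi> \<union> all_vars \<psi>"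
| "all_vars (Imp \<phi> \<psi>) = all_vars \<phi> \<union> all_vars \<psi>"
| "all_vars (Iff \<phi> \<psi>) = all_vars \<phi> \<union> all_vars \<psi>"
| "all_vars (Forall x \<phi>) = insert x (all_vars \<phi>)"
| "all_vars (Exists x \<phi>) = insert x (all_vars \<phi>)"
| "all_vars (Box \<alpha> \<phi>) = prog_all_vars \<alpha> \<union> all_vars \<phi>"
| "all_vars (Dia \<alpha> \<phi>) = prog_all_vars \<alpha> \<union> all_vars \<phi>"
| "prog_all_vars (Assign x e) = insert x (term_vars e)"
| "prog_all_vars (Test \<phi>) = all_vars \<phi>"
| "prog_all_vars (ODE ode Q) = ode_vars ode \<union> (\<Union>(x, e)\<in>set ode. term_vars e) \<union> all_vars Q"
| "prog_all_vars (Choice \<alpha> \<beta>) = prog_all_vars \<alpha> \<union> prog_all_vars \<beta>"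
| "prog_all_vars (Compose \<alpha> \<beta>) = prog_all_vars \<alpha> \<union> prog_all_vars \<beta>"
| "prog_all_vars (Star \<alpha>) = prog_all_vars \<alpha>"


section \<open>Substitution\<close>

text \<open>\<open>subst x e \<phi>\<close> replaces the free occurrences of \<open>x\<close> by \<open>e\<close>. It does not rename bound
  variables and is meaningful only if \<open>free_for x e \<phi>\<close>: no free occurrence of \<open>x\<close> lies in the
  scope of a quantifier or program that may bind \<open>x\<close> or a variable of \<open>e\<close>. In an ODE system,
  the variables \<open>x\<^sub>i\<close> occur both free and bound, so nothing can be substituted for them.\<close>

primrec subst :: "var \<Rightarrow> trm \<Rightarrow> fml \<Rightarrow> fml" and prog_subst :: "var \<Rightarrow> trm \<Rightarrow> prog \<Rightarrow> prog" where
  "subst x e (Eq s t) = Eq (term_subst x e s) (term_subst x e t)"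
| "subst x e (Geq s t) = Geq (term_subst x e s) (term_subst x e t)"
| "subst x e (Gt s t) = Gt (term_subst x e s) (term_subst x e t)"
| "subst x e (Neg \<phi>) = Neg (subst x e \<phi>)"
| "subst x e (Conj \<phi> \<psi>) = Conj (subst x e \<phi>) (subst x e \<psi>)"
| "subst x e (Disj \<phi> \<psi>) = Disj (subst x e \<phi>) (subst x e \<psi>)"
| "subst x e (Imp \<phi> \<psi>) = Imp (subst x e \<phi>) (subst x e \<psi>)"
| "subst x e (Iff \<phi> \<psi>) = Iff (subst x e \<phi>) (subst x e \<psi>)"
| "subst x e (Forall y \<phi>) = Forall y (if y = x then \<phi> else subst x e \<phi>)"
| "subst x e (Exists y \<phi>) = Exists y (if y = x then \<phi> else subst x e \<phi>)"
| "subst x e (Box \<alpha> \<phi>) = Box (prog_subst x e \<alpha>) (if x \<in> bound_vars \<alpha> then \<phi> else subst x e \<phi>)"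
| "subst x e (Dia \<alpha> \<phi>) = Dia (prog_subst x e \<alpha>) (if x \<in> bound_vars \<alpha> then \<phi> else subst x e \<phi>)"
| "prog_subst x e (Assign y t) = Assign y (term_subst x e t)"
| "prog_subst x e (Test \<phi>) = Test (subst x e \<phi>)"
| "prog_subst x e (ODE ode Q) = ODE (map (\<lambda>(y, t). (y, term_subst x e t)) ode) (subst x e Q)"
| "prog_subst x e (Choice \<alpha> \<beta>) = Choice (prog_subst x e \<alpha>) (prog_subst x e \<beta>)"
| "prog_subst x e (Compose \<alpha> \<beta>) =
     Compose (prog_subst x e \<alpha>) (if x \<in> bound_vars \<alpha> then \<beta> else prog_subst x e \<beta>)"
| "prog_subst x e (Star \<alpha>) = Star (prog_subst x e \<alpha>)"

primrec admissible :: "var \<Rightarrow> trm \<Rightarrow> fml \<Rightarrow> bool"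
  and prog_admissible :: "var \<Rightarrow> trm \<Rightarrow> prog \<Rightarrow> bool" where
  "admissible x e (Eq s t) = True"
| "admissible x e (Geq s t) = True"
| "admissible x e (Gt s t) = True"
| "admissible x e (Neg \<phi>) = admissible x e \<phi>"
| "admissible x e (Conj \<phi> \<psi>) = (admissible x e \<phi> \<and> admissible x e \<psi>)"
| "admissible x e (Disj \<phi> \<psi>) = (admissible x e \<phi> \<and> admissible x e \<psi>)"
| "admissible x e (Imp \<phi> \<psi>) = (admissible x e \<phi> \<and> admissible x e \<psi>)"
| "admissible x e (Iff \<phi> \<psi>) = (admissible x e \<phi> \<and> admissible x e \<psi>)"
| "admissible x e (Forall y \<phi>) =
     (y = x \<or> x \<notin> free_vars \<phi> \<or> y \<notin> term_vars e \<and> admissible x e \<phi>)"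
| "admissible x e (Exists y \<phi>) =
     (y = x \<or> x \<notin> free_vars \<phi> \<or> y \<notin> term_vars e \<and> admissible x e \<phi>)"
| "admissible x e (Box \<alpha> \<phi>) =
     (prog_admissible x e \<alpha> \<and>
      (x \<in> must_bound_vars \<alpha> \<or> x \<notin> free_vars \<phi> \<or>
       bound_vars \<alpha> \<inter> insert x (term_vars e) = {} \<and> admissible x e \<phi>))"
| "admissible x e (Dia \<alpha> \<phi>) =
     (prog_admissible x e \<alpha> \<and>
      (x \<in> must_bound_vars \<alpha> \<or> x \<notin> free_vars \<phi> \<or>
       bound_vars \<alpha> \<inter> insert x (term_vars e) = {} \<and> admissible x e \<phi>))"
| "prog_admissible x e (Assign y t) = True"
| "prog_admissible x e (Test \<phi>) = admissible x e \<phi>"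
| "prog_admissible x e (ODE ode Q) =
     (x \<notin> prog_free_vars (ODE ode Q) \<or>
      ode_vars ode \<inter> insert x (term_vars e) = {} \<and> admissible x e Q)"
| "prog_admissible x e (Choice \<alpha> \<beta>) = (prog_admissible x e \<alpha> \<and> prog_admissible x e \<beta>)"
| "prog_admissible x e (Compose \<alpha> \<beta>) =
     (prog_admissible x e \<alpha> \<and>
      (x \<in> must_bound_vars \<alpha> \<or> x \<notin> prog_free_vars \<beta> \<or>
       bound_vars \<alpha> \<inter> insert x (term_vars e) = {} \<and> prog_admissible x e \<beta>))"
| "prog_admissible x e (Star \<alpha>) =
     (x \<notin> prog_free_vars \<alpha> \<or>
      bound_vars \<alpha> \<inter> insert x (term_vars e) = {} \<and> prog_admissible x e \<alpha>)"

text \<open>Replacing \<open>x\<close> by itself is the identity and therefore always allowed, also for the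
  variables of an ODE system.\<close>

definition free_for :: "var \<Rightarrow> trm \<Rightarrow> fml \<Rightarrow> bool" where
  "free_for x e \<phi> \<longleftrightarrow> e = Var x \<or> admissible x e \<phi>"


section \<open>The base calculus\<close>

definition ghost_ode :: "var list \<Rightarrow> (nat \<Rightarrow> nat \<Rightarrow> trm) \<Rightarrow> (nat \<Rightarrow> trm) \<Rightarrow> ode" where
  "ghost_ode ys a b =
     map (\<lambda>i. (ys ! i, Add (tsum (map (\<lambda>j. Mult (a i j) (Var (ys ! j))) [0..<length ys])) (b i)))
       [0..<length ys]"

text \<open>In \<open>B'\<close> the quantified variable must not occur in the right-hand sides or in the domain
  constraint either: these may mention parameters, for which the equivalence is unsound.\<close>

inductive base_axiom :: "fml \<Rightarrow> bool" where
  diamond: "base_axiom (Iff (Dia \<alpha> \<phi>) (Neg (Box \<alpha> (Neg \<phi>))))"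
| assign: "free_for x e \<phi> \<Longrightarrow> base_axiom (Iff (Box (Assign x e) \<phi>) (subst x e \<phi>))"
| test: "base_axiom (Iff (Box (Test \<psi>) \<phi>) (Imp \<psi> \<phi>))"
| choice: "base_axiom (Iff (Box (Choice \<alpha> \<beta>) \<phi>) (Conj (Box \<alpha> \<phi>) (Box \<beta> \<phi>)))"
| compose: "base_axiom (Iff (Box (Compose \<alpha> \<beta>) \<phi>) (Box \<alpha> (Box \<beta> \<phi>)))"
| iterate: "base_axiom (Iff (Box (Star \<alpha>) \<phi>) (Conj \<phi> (Box \<alpha> (Box (Star \<alpha>) \<phi>))))"
| K: "base_axiom (Imp (Box \<alpha> (Imp \<phi> \<psi>)) (Imp (Box \<alpha> \<phi>) (Box \<alpha> \<psi>)))"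
| I: "base_axiom (Iff (Box (Star \<alpha>) \<phi>) (Conj \<phi> (Box (Star \<alpha>) (Imp \<phi> (Box \<alpha> \<phi>)))))"
| V: "free_vars \<phi> \<inter> bound_vars \<alpha> = {} \<Longrightarrow> base_axiom (Imp \<phi> (Box \<alpha> \<phi>))"
| DW: "base_axiom (Box (ODE ode Q) Q)"
| DI_Geq: "base_axiom
    (Imp (Imp Q (Box (ODE ode Q) (Geq (lie ode p) (Const 0))))
      (Iff (Box (ODE ode Q) (Geq p (Const 0))) (Imp Q (Geq p (Const 0)))))"
| DI_Gt: "base_axiom
    (Imp (Imp Q (Box (ODE ode Q) (Geq (lie ode p) (Const 0))))
      (Iff (Box (ODE ode Q) (Gt p (Const 0))) (Imp Q (Gt p (Const 0)))))"
| DI_Eq: "base_axiom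
    (Imp (Imp Q (Box (ODE ode Q) (Eq (lie ode p) (Const 0))))
      (Iff (Box (ODE ode Q) (Eq p (Const 0))) (Imp Q (Eq p (Const 0)))))"
| DMP: "base_axiom
    (Imp (Box (ODE ode Q) (Imp Q R)) (Imp (Box (ODE ode R) \<phi>) (Box (ODE ode Q) \<phi>)))"
| DG: "\<lbrakk>distinct ys; set ys \<inter> all_vars (Box (ODE ode Q) \<phi>) = {};
    \<forall>i<length ys. \<forall>j<length ys. term_vars (a i j) \<inter> set ys = {};
    \<forall>i<length ys. term_vars (b i) \<inter> set ys = {}\<rbrakk> \<Longrightarrow>
    base_axiom
      (Iff (Box (ODE ode Q) \<phi>) (foldr Exists ys (Box (ODE (ode @ ghost_ode ys a b) Q) \<phi>)))"
| B': "y \<notin> prog_free_vars (ODE ode Q) \<Longrightarrow>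
    base_axiom (Iff (Dia (ODE ode Q) (Exists y \<phi>)) (Exists y (Dia (ODE ode Q) \<phi>)))"

text \<open>\<open>derivable H \<Gamma> \<phi>\<close>: there is a derivation of the sequent \<open>\<Gamma> \<turnstile> \<phi>\<close> in the base calculus whose
  open premises are sequents in \<open>H\<close>. So the rule with premises \<open>H\<close> and conclusion \<open>\<Gamma> \<turnstile> \<phi>\<close> is
  derived iff \<open>derivable H \<Gamma> \<phi>\<close>. Sequents have exactly one succedent; the calculus is classical
  because of \<open>RAA\<close>.\<close>

type_synonym sequent = "fml set \<times> fml"

inductive derivable :: "sequent set \<Rightarrow> fml set \<Rightarrow> fml \<Rightarrow> bool" for H :: "sequent set" where
  premise: "(\<Gamma>, \<phi>) \<in> H \<Longrightarrow> derivable H \<Gamma> \<phi>"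
| axiom: "\<lbrakk>base_axiom \<phi>; wf_fml \<phi>\<rbrakk> \<Longrightarrow> derivable H {} \<phi>"
| real_arith: "\<lbrakk>fo \<phi>; valid \<phi>\<rbrakk> \<Longrightarrow> derivable H {} \<phi>"
| G: "\<lbrakk>derivable H {} \<phi>; wf_prog \<alpha>\<rbrakk> \<Longrightarrow> derivable H {} (Box \<alpha> \<phi>)"
| ident: "wf_fml \<phi> \<Longrightarrow> derivable H {\<phi>} \<phi>"
| weaken: "\<lbrakk>derivable H \<Gamma> \<phi>; \<Gamma> \<subseteq> \<Gamma>'; finite \<Gamma>'; \<forall>\<psi>\<in>\<Gamma>'. wf_fml \<psi>\<rbrakk> \<Longrightarrow> derivable H \<Gamma>' \<phi>"
| cut: "\<lbrakk>derivable H \<Gamma> \<phi>; derivable H (insert \<phi> \<Gamma>) \<psi>\<rbrakk> \<Longrightarrow> derivable H \<Gamma> \<psi>"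
| RAA: "derivable H (insert (Neg \<phi>) \<Gamma>) \<phi> \<Longrightarrow> derivable H \<Gamma> \<phi>"
| NegL: "\<lbrakk>derivable H \<Gamma> \<phi>; wf_fml \<psi>\<rbrakk> \<Longrightarrow> derivable H (insert (Neg \<phi>) \<Gamma>) \<psi>"
| NegR: "derivable H (insert \<phi> \<Gamma>) (Neg \<phi>) \<Longrightarrow> derivable H \<Gamma> (Neg \<phi>)"
| ConjL: "derivable H (insert \<phi> (insert \<psi> \<Gamma>)) \<theta> \<Longrightarrow> derivable H (insert (Conj \<phi> \<psi>) \<Gamma>) \<theta>"
| ConjR: "\<lbrakk>derivable H \<Gamma> \<phi>; derivable H \<Gamma> \<psi>\<rbrakk> \<Longrightarrow> derivable H \<Gamma> (Conj \<phi> \<psi>)"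
| DisjL: "\<lbrakk>derivable H (insert \<phi> \<Gamma>) \<theta>; derivable H (insert \<psi> \<Gamma>) \<theta>\<rbrakk> \<Longrightarrow>
    derivable H (insert (Disj \<phi> \<psi>) \<Gamma>) \<theta>"
| DisjR1: "\<lbrakk>derivable H \<Gamma> \<phi>; wf_fml \<psi>\<rbrakk> \<Longrightarrow> derivable H \<Gamma> (Disj \<phi> \<psi>)"
| DisjR2: "\<lbrakk>derivable H \<Gamma> \<psi>; wf_fml \<phi>\<rbrakk> \<Longrightarrow> derivable H \<Gamma> (Disj \<phi> \<psi>)"
| ImpL: "\<lbrakk>derivable H \<Gamma> \<phi>; derivable H (insert \<psi> \<Gamma>) \<theta>\<rbrakk> \<Longrightarrow> derivable H (insert (Imp \<phi> \<psi>) \<Gamma>) \<theta>"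
| ImpR: "derivable H (insert \<phi> \<Gamma>) \<psi> \<Longrightarrow> derivable H \<Gamma> (Imp \<phi> \<psi>)"
| IffL: "derivable H (insert (Imp \<phi> \<psi>) (insert (Imp \<psi> \<phi>) \<Gamma>)) \<theta> \<Longrightarrow>
    derivable H (insert (Iff \<phi> \<psi>) \<Gamma>) \<theta>"
| IffR: "\<lbrakk>derivable H (insert \<phi> \<Gamma>) \<psi>; derivable H (insert \<psi> \<Gamma>) \<phi>\<rbrakk> \<Longrightarrow>
    derivable H \<Gamma> (Iff \<phi> \<psi>)"
| ForallL: "\<lbrakk>derivable H (insert (subst x e \<phi>) \<Gamma>) \<theta>; free_for x e \<phi>; wf_fml \<phi>\<rbrakk> \<Longrightarrow>
    derivable H (insert (Forall x \<phi>) \<Gamma>) \<theta>"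
| ForallR: "\<lbrakk>derivable H \<Gamma> (subst x (Var y) \<phi>); free_for x (Var y) \<phi>; wf_fml \<phi>;
    \<forall>\<psi>\<in>insert (Forall x \<phi>) \<Gamma>. y \<notin> free_vars \<psi>\<rbrakk> \<Longrightarrow> derivable H \<Gamma> (Forall x \<phi>)"
| ExistsL: "\<lbrakk>derivable H (insert (subst x (Var y) \<phi>) \<Gamma>) \<theta>; free_for x (Var y) \<phi>; wf_fml \<phi>;
    \<forall>\<psi>\<in>insert \<theta> (insert (Exists x \<phi>) \<Gamma>). y \<notin> free_vars \<psi>\<rbrakk> \<Longrightarrow>
    derivable H (insert (Exists x \<phi>) \<Gamma>) \<theta>"
| ExistsR: "\<lbrakk>derivable H \<Gamma> (subst x e \<phi>); free_for x e \<phi>; wf_fml \<phi>\<rbrakk> \<Longrightarrow>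
    derivable H \<Gamma> (Exists x \<phi>)"

end

theory Submission
  imports Defs
begin

text \<open>Write \<open>P\<^sub>i\<close> for the \<open>i\<close>-th Lie derivative of \<open>p\<close>, \<open>s = \<Sum>\<^sub>i\<^sub><\<^sub>N P\<^sub>i\<^sup>2\<close> and \<open>h = \<Sum>\<^sub>i\<^sub><\<^sub>N (2 + g\<^sub>i\<^sup>2)\<close>. On \<open>Q\<close>
  the second premise gives \<open>s' \<le> 2hs\<close> because \<open>\<bar>P\<^sub>iP\<^sub>j\<bar> \<le> s\<close>. Add the ghosts
  \<open>y' = -hy\<close>, \<open>z' = hz\<close> with \<open>y = z = 1\<close> initially. Then \<open>yz = 1\<close> and \<open>-sy\<^sup>2 \<ge> 0\<close> are differential
  invariants, the latter because \<open>(sy\<^sup>2)' = (s' - 2hs) y\<^sup>2 \<le> 0\<close>. The former implies \<open>y \<noteq> 0\<close>, so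
  together they force \<open>s = 0\<close> and hence \<open>p = 0\<close>.\<close>

section \<open>Lie derivatives\<close>

lemma term_sem_tsum: "term_sem (tsum ts) \<sigma> = (\<Sum>t\<leftarrow>ts. term_sem t \<sigma>)"
  by (induction ts rule: tsum.induct) auto

lemma term_vars_tsum: "term_vars (tsum ts) = (\<Union>t\<in>set ts. term_vars t)"
  by (induction ts rule: tsum.induct) auto

lemma term_vars_pdiff: "term_vars (pdiff x t) \<subseteq> term_vars t"
  by (induction t) auto

lemma term_vars_lie: "term_vars (lie ode t) \<subseteq> term_vars t \<union> (\<Union>(x, e)\<in>set ode. term_vars e)"
  using term_vars_pdiff by (fastforce simp: lie_def term_vars_tsum)

text \<open>One choice of ghosts outside \<open>V\<close> is thereby fresh for all iterated Lie
  derivatives at once.\<close>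

lemma term_vars_lie_funpow:
  assumes "\<forall>(x, e)\<in>set ode. term_vars e \<subseteq> V" "term_vars t \<subseteq> V"
  shows "term_vars ((lie ode ^^ i) t) \<subseteq> V"
proof (induction i)
  case (Suc i)
  then show ?case using term_vars_lie[of ode "(lie ode ^^ i) t"] assms(1) by fastforce
qed (use assms in simp)

lemma term_sem_pdiff_notin: "x \<notin> term_vars t \<Longrightarrow> term_sem (pdiff x t) \<sigma> = 0"
  by (induction t) auto

text \<open>\<open>lie\<close> produces unsimplified syntax, so linearity and the Leibniz rule hold
  only for values. That suffices, since \<open>real_arith\<close> makes every valid identity between
  values derivable.\<close>

lemma term_sem_lie:
  "term_sem (lie ode t) \<sigma> = (\<Sum>(x, e)\<leftarrow>ode. term_sem (pdiff x t) \<sigma> * term_sem e \<sigma>)"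
  by (simp add: lie_def term_sem_tsum o_def case_prod_unfold)

lemma term_sem_lie_Add:
  "term_sem (lie ode (Add s t)) \<sigma> = term_sem (lie ode s) \<sigma> + term_sem (lie ode t) \<sigma>"
  unfolding term_sem_lie by (induction ode) (auto simp: algebra_simps)

lemma term_sem_lie_Mult:
  "term_sem (lie ode (Mult s t)) \<sigma> =
    term_sem (lie ode s) \<sigma> * term_sem t \<sigma> + term_sem s \<sigma> * term_sem (lie ode t) \<sigma>"
  unfolding term_sem_lie by (induction ode) (auto simp: algebra_simps)

lemma term_sem_lie_Const: "term_sem (lie ode (Const c)) \<sigma> = 0"
  unfolding term_sem_lie by (induction ode) auto

lemma term_sem_lie_tsum:
  "term_sem (lie ode (tsum ts)) \<sigma> = (\<Sum>t\<leftarrow>ts. term_sem (lie ode t) \<sigma>)"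
  by (induction ts rule: tsum.induct) (auto simp: term_sem_lie_Add term_sem_lie_Const)

text \<open>Used in both directions for a system extended by ghosts: the ghosts do not affect
  derivatives of old terms, and the old equations do not affect derivatives of ghosts.\<close>

lemma term_sem_lie_notin:
  "ode_vars ode \<inter> term_vars t = {} \<Longrightarrow> term_sem (lie ode t) \<sigma> = 0"
  unfolding term_sem_lie by (induction ode) (auto simp: term_sem_pdiff_notin)

lemma term_sem_lie_append:
  "term_sem (lie (ode @ ode') t) \<sigma> = term_sem (lie ode t) \<sigma> + term_sem (lie ode' t) \<sigma>"
  by (simp add: term_sem_lie)

section \<open>Derived rules of the base calculus\<close>

lemma fo_imp_wf_fml: "fo \<phi> \<Longrightarrow> wf_fml \<phi>"
  by (induction \<phi> rule: fml.induct[where ?P2.0 = "\<lambda>_. True"]) auto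

lemma fo_conjs: "fo (conjs \<phi>s) \<longleftrightarrow> (\<forall>\<phi>\<in>set \<phi>s. fo \<phi>)"
  by (induction \<phi>s rule: conjs.induct) auto

lemma fml_sem_conjs: "fml_sem (conjs \<phi>s) \<sigma> \<longleftrightarrow> (\<forall>\<phi>\<in>set \<phi>s. fml_sem \<phi> \<sigma>)"
  by (induction \<phi>s rule: conjs.induct) auto

lemma term_subst_Var: "term_subst x (Var x) t = t"
  by (induction t) auto

lemma subst_Var: "subst x (Var x) \<phi> = \<phi>" and prog_subst_Var: "prog_subst x (Var x) \<alpha> = \<alpha>"
  by (induction \<phi> and \<alpha>) (auto simp: term_subst_Var)

lemma finite_term_vars: "finite (term_vars t)"
  by (induction t) auto

lemma finite_all_vars: "finite (all_vars \<phi>)" and finite_prog_all_vars: "finite (prog_all_vars \<alpha>)"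
  by (induction \<phi> and \<alpha>) (auto simp: finite_term_vars)

lemma free_vars_subset_all_vars:
  shows "free_vars \<phi> \<subseteq> all_vars \<phi>" and "prog_free_vars \<alpha> \<subseteq> prog_all_vars \<alpha>"
  by (induction \<phi> and \<alpha>) auto

lemma finite_free_vars: "finite (free_vars \<phi>)"
  using free_vars_subset_all_vars(1) finite_all_vars by (rule finite_subset)

definition wf_context :: "fml set \<Rightarrow> bool" where
  "wf_context \<Gamma> \<longleftrightarrow> finite \<Gamma> \<and> (\<forall>\<phi>\<in>\<Gamma>. wf_fml \<phi>)"

lemma wf_context_insert [simp]: "wf_context (insert \<phi> \<Gamma>) \<longleftrightarrow> wf_fml \<phi> \<and> wf_context \<Gamma>"
  by (auto simp: wf_context_def)

lemma derivable_weaken: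
  "\<lbrakk>derivable H \<Gamma> \<phi>; \<Gamma> \<subseteq> \<Gamma>'; wf_context \<Gamma>'\<rbrakk> \<Longrightarrow> derivable H \<Gamma>' \<phi>"
  by (auto simp: wf_context_def intro: derivable.weaken)

lemma derivable_assumption:
  "\<lbrakk>\<phi> \<in> \<Gamma>; wf_context \<Gamma>\<rbrakk> \<Longrightarrow> derivable H \<Gamma> \<phi>"
  by (rule derivable_weaken[OF derivable.ident]) (auto simp: wf_context_def)

lemma derivable_mp:
  assumes "derivable H \<Gamma> (Imp \<phi> \<psi>)" "derivable H \<Gamma> \<phi>" "wf_context \<Gamma>" "wf_fml \<psi>"
  shows "derivable H \<Gamma> \<psi>"
  by (rule derivable.cut[OF assms(1) derivable.ImpL[OF assms(2) derivable_assumption]])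
    (use assms in auto)

lemma derivable_mp_theorem:
  assumes "derivable H {} (Imp \<phi> \<psi>)" "derivable H \<Gamma> \<phi>" "wf_context \<Gamma>" "wf_fml \<psi>"
  shows "derivable H \<Gamma> \<psi>"
  using derivable_mp[OF derivable_weaken[OF assms(1)]] assms by blast

lemma derivable_iff_right_to_left:
  assumes "derivable H \<Gamma> (Iff \<phi> \<psi>)" "derivable H \<Gamma> \<psi>" "wf_context \<Gamma>" "wf_fml \<phi>" "wf_fml \<psi>"
  shows "derivable H \<Gamma> \<phi>"
proof -
  have "derivable H (insert (Imp \<phi> \<psi>) (insert (Imp \<psi> \<phi>) \<Gamma>)) \<phi>"
    by (rule derivable_mp[OF derivable_assumption derivable_weaken[OF assms(2)]])
      (use assms in auto)
  then show ?thesis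
    using assms(1) derivable.IffL derivable.cut by blast
qed

text \<open>\<open>G\<close> puts an implication under the box and \<open>K\<close> distributes the
  box over it. As \<open>G\<close> admits no context, the implication must be a theorem, while the
  box itself may depend on \<open>\<Gamma>\<close>.\<close>

lemma derivable_box_mono:
  assumes "derivable H {} (Imp \<phi> \<psi>)" "derivable H \<Gamma> (Box \<alpha> \<phi>)"
    and wf: "wf_context \<Gamma>" "wf_prog \<alpha>" "wf_fml \<phi>" "wf_fml \<psi>"
  shows "derivable H \<Gamma> (Box \<alpha> \<psi>)"
proof -
  have "derivable H {} (Imp (Box \<alpha> \<phi>) (Box \<alpha> \<psi>))"
    by (rule derivable_mp[OF derivable.axiom[OF base_axiom.K] derivable.G[OF assms(1)]])
      (use wf in \<open>auto simp: wf_context_def\<close>)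
  then show ?thesis
    by (rule derivable_mp_theorem) (use assms in auto)
qed

text \<open>Currying combines two postconditions through \<open>K\<close> without a box over a
  conjunction.\<close>

lemma derivable_box_mono2:
  assumes "derivable H {} (Imp \<phi> (Imp \<psi> \<theta>))" "derivable H \<Gamma> (Box \<alpha> \<phi>)" "derivable H \<Gamma> (Box \<alpha> \<psi>)"
    and wf: "wf_context \<Gamma>" "wf_prog \<alpha>" "wf_fml \<phi>" "wf_fml \<psi>" "wf_fml \<theta>"
  shows "derivable H \<Gamma> (Box \<alpha> \<theta>)"
proof -
  have "derivable H \<Gamma> (Box \<alpha> (Imp \<psi> \<theta>))"
    by (rule derivable_box_mono[OF assms(1,2)]) (use wf in auto)
  then have "derivable H \<Gamma> (Imp (Box \<alpha> \<psi>) (Box \<alpha> \<theta>))"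
    by (intro derivable_mp_theorem[OF derivable.axiom[OF base_axiom.K]]) (use wf in auto)
  then show ?thesis
    by (rule derivable_mp) (use assms in auto)
qed

text \<open>\<open>DW\<close> yields the box over \<open>Q\<close>, which \<open>step\<close>
  carries to \<open>\<theta>\<close> by monotonicity. So \<open>step\<close> may use
  \<open>Q\<close> but not \<open>\<Gamma>\<close>, which may fail along the flow;
  \<open>\<Gamma>\<close> is available only in \<open>init\<close>. Leaving \<open>\<phi>\<close>
  and \<open>\<theta>\<close> open serves both \<open>DI_Eq\<close> and
  \<open>DI_Geq\<close>.\<close>

lemma derivable_diff_inv:
  assumes DI: "base_axiom (Imp (Imp Q (Box (ODE ode Q) \<theta>)) (Iff (Box (ODE ode Q) \<phi>) (Imp Q \<phi>)))"
    and step: "derivable H {Q} \<theta>" and init: "derivable H (insert Q \<Gamma>) \<phi>"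
    and wf: "wf_context \<Gamma>" "distinct (map fst ode)" "fo Q" "wf_fml \<phi>" "wf_fml \<theta>"
  shows "derivable H \<Gamma> (Box (ODE ode Q) \<phi>)"
proof -
  note wf_Q = fo_imp_wf_fml[OF \<open>fo Q\<close>]
  have "derivable H {} (Box (ODE ode Q) \<theta>)"
    by (rule derivable_box_mono[OF derivable.ImpR[OF step] derivable.axiom[OF base_axiom.DW]])
      (use wf wf_Q in \<open>auto simp: wf_context_def\<close>)
  then have "derivable H (insert Q \<Gamma>) (Box (ODE ode Q) \<theta>)"
    by (rule derivable_weaken) (use wf wf_Q in auto)
  then have "derivable H \<Gamma> (Imp Q (Box (ODE ode Q) \<theta>))"
    by (rule derivable.ImpR)
  then have "derivable H \<Gamma> (Iff (Box (ODE ode Q) \<phi>) (Imp Q \<phi>))"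
    by (intro derivable_mp_theorem[OF derivable.axiom[OF DI]]) (use wf wf_Q in auto)
  then show ?thesis
    by (rule derivable_iff_right_to_left) (use wf wf_Q derivable.ImpR[OF init] in auto)
qed

text \<open>A term cannot be substituted for the bound variable of an ODE system, so an initial value is
  introduced by an equation for the quantified variable, which is then its own witness.\<close>

lemma derivable_Exists_initial_value:
  assumes "derivable H (insert (Eq (Var y) (Const c)) \<Gamma>) \<phi>"
    and "\<forall>\<psi>\<in>\<Gamma>. y \<notin> free_vars \<psi>" "wf_context \<Gamma>" "wf_fml \<phi>"
  shows "derivable H \<Gamma> (Exists y \<phi>)"
proof -
  let ?eq = "Eq (Var y) (Const c)"
  have "derivable H (insert ?eq \<Gamma>) (Exists y \<phi>)"
    by (rule derivable.ExistsR[where e = "Var y"])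
      (use assms in \<open>auto simp: subst_Var free_for_def\<close>)
  then have *: "derivable H (insert (Exists y ?eq) \<Gamma>) (Exists y \<phi>)"
    by (intro derivable.ExistsL[where y = y])
      (use assms in \<open>auto simp: free_for_def\<close>)
  have "derivable H {} (Exists y ?eq)"
    by (rule derivable.real_arith) (auto simp: valid_def)
  then have "derivable H \<Gamma> (Exists y ?eq)"
    by (rule derivable_weaken) (simp_all add: assms)
  then show ?thesis using * by (rule derivable.cut)
qed

section \<open>The rule dRI\<close>

text \<open>The left side is half of \<open>s'\<close>. With \<open>N = Suc n\<close>, each of the
  first \<open>n\<close> products is at most \<open>s\<close>. The last one,
  \<open>P n * P N\<close>, expands by the assumption, and
  \<open>\<bar>g j\<bar> \<le> 1 + (g j)\<^sup>2\<close> bounds its summands by multiples of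
  \<open>s\<close>. This bound, unlike \<open>\<bar>g j\<bar>\<close>, is a polynomial and so
  expressible as a term.\<close>

lemma sum_mult_shift_le:
  fixes P g :: "nat \<Rightarrow> real"
  assumes "P N = (\<Sum>j<N. g j * P j)"
  shows "(\<Sum>i<N. P i * P (Suc i)) \<le> (\<Sum>i<N. 2 + (g i)\<^sup>2) * (\<Sum>i<N. (P i)\<^sup>2)"
proof (cases N)
  case (Suc n)
  define s where "s = (\<Sum>i<N. (P i)\<^sup>2)"
  have abs_le: "\<bar>P i * P j\<bar> \<le> s" if "i < N" "j < N" for i j
  proof -
    have "(P k)\<^sup>2 \<le> s" if "k < N" for k
      unfolding s_def using that by (intro member_le_sum) auto
    with that have "(P i)\<^sup>2 \<le> s" "(P j)\<^sup>2 \<le> s" by blast+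
    moreover have "2 * \<bar>P i * P j\<bar> \<le> (P i)\<^sup>2 + (P j)\<^sup>2"
      using sum_squares_bound[of "\<bar>P i\<bar>" "\<bar>P j\<bar>"] by (simp add: abs_mult)
    ultimately show ?thesis by linarith
  qed
  have "s \<ge> 0" unfolding s_def by (simp add: sum_nonneg)
  have "(\<Sum>i<n. P i * P (Suc i)) \<le> (\<Sum>i<n. s)"
    by (intro sum_mono) (use abs_le Suc in \<open>fastforce intro: order_trans[OF abs_ge_self]\<close>)
  \<comment> \<open>One extra copy of \<open>s\<close> makes the count \<open>N\<close>, matching
    one unit of each \<open>2\<close> in the factor; the other unit belongs to
    \<open>1 + (g j)\<^sup>2\<close>.\<close>
  also have "\<dots> \<le> (\<Sum>i<N. s)"
    using Suc \<open>s \<ge> 0\<close> by (simp add: mult_right_mono)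
  finally have 1: "(\<Sum>i<n. P i * P (Suc i)) \<le> (\<Sum>i<N. s)" .
  have "P n * P N = (\<Sum>j<N. g j * (P n * P j))"
    unfolding assms sum_distrib_left by (simp add: mult_ac)
  also have "\<dots> \<le> (\<Sum>j<N. (1 + (g j)\<^sup>2) * s)"
  proof (intro sum_mono)
    fix j assume "j \<in> {..<N}"
    have "g j * (P n * P j) \<le> \<bar>g j\<bar> * \<bar>P n * P j\<bar>"
      by (metis abs_ge_self abs_mult)
    also have "\<dots> \<le> (1 + (g j)\<^sup>2) * s"
    proof (intro mult_mono)
      show "\<bar>g j\<bar> \<le> 1 + (g j)\<^sup>2"
        using sum_squares_bound[of "\<bar>g j\<bar>" 1] by simp
    qed (use abs_le \<open>j \<in> _\<close> Suc in auto)
    finally show "g j * (P n * P j) \<le> (1 + (g j)\<^sup>2) * s" .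
  qed
  finally have "P n * P N \<le> (\<Sum>j<N. (1 + (g j)\<^sup>2) * s)" .
  moreover have "(\<Sum>i<N. P i * P (Suc i)) = (\<Sum>i<n. P i * P (Suc i)) + P n * P N"
    by (simp add: Suc)
  moreover have "(\<Sum>i<N. 2 + (g i)\<^sup>2) * s = (\<Sum>i<N. s) + (\<Sum>j<N. (1 + (g j)\<^sup>2) * s)"
    unfolding sum_distrib_right sum.distrib[symmetric] by (simp add: algebra_simps)
  ultimately show ?thesis using 1 unfolding s_def by linarith
qed simp

theorem theorem4:
  fixes ode :: ode and Q :: fml and \<Gamma> :: "fml set" and p :: trm and N :: nat
    and g :: "nat \<Rightarrow> trm"
  assumes "distinct (map fst ode)"
    and "\<forall>(x, e)\<in>set ode. term_vars e \<subseteq> ode_vars ode"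
    and "fo Q"
    and "finite \<Gamma>" and "\<forall>\<phi>\<in>\<Gamma>. wf_fml \<phi>"
    and "term_vars p \<subseteq> ode_vars ode"
    and "N \<ge> 1"
    and "\<forall>i<N. term_vars (g i) \<subseteq> ode_vars ode"
  shows "derivable
    {(insert Q \<Gamma>, conjs (map (\<lambda>i. Eq ((lie ode ^^ i) p) (Const 0)) [0..<N])),
     ({Q}, Eq ((lie ode ^^ N) p) (tsum (map (\<lambda>i. Mult (g i) ((lie ode ^^ i) p)) [0..<N])))}
    \<Gamma> (Box (ODE ode Q) (Eq p (Const 0)))"
proof -
  define P where "P i = (lie ode ^^ i) p" for i
  define C where "C = conjs (map (\<lambda>i. Eq (P i) (Const 0)) [0..<N])"
  define E where "E = Eq (P N) (tsum (map (\<lambda>i. Mult (g i) (P i)) [0..<N]))"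
  define H where "H = {(insert Q \<Gamma>, C), ({Q}, E)}"
  define s where "s = tsum (map (\<lambda>i. Mult (P i) (P i)) [0..<N])"
  define h where "h = tsum (map (\<lambda>i. Add (Const 2) (Mult (g i) (g i))) [0..<N])"

  have ctx: "wf_context \<Gamma>"
    using assms(4,5) by (simp add: wf_context_def)
  have vars_P: "term_vars (P i) \<subseteq> ode_vars ode" for i
    unfolding P_def using term_vars_lie_funpow assms(2,6) by blast
  have vars_h: "term_vars h \<subseteq> ode_vars ode"
    using assms(8) by (auto simp: h_def term_vars_tsum)

  \<comment> \<open>\<open>DG\<close> needs ghosts outside \<open>all_vars\<close> of the box
    formula, and \<open>ExistsL\<close> needs them not free in \<open>\<Gamma>\<close>. As
    \<open>V\<close> contains \<open>ode_vars ode\<close>, they are also fresh for every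
    \<open>P i\<close> and for \<open>h\<close>.\<close>
  define V where "V = all_vars (Box (ODE ode Q) (Eq p (Const 0))) \<union> (\<Union>\<phi>\<in>\<Gamma>. free_vars \<phi>)"
  have "finite V"
    unfolding V_def using assms(4) finite_all_vars finite_free_vars by blast
  then obtain y where y: "y \<notin> V"
    using ex_new_if_finite infinite_UNIV_nat by blast
  obtain z where z: "z \<notin> insert y V"
    using ex_new_if_finite[of "insert y V"] infinite_UNIV_nat \<open>finite V\<close> by blast
  have ode_V: "ode_vars ode \<subseteq> V"
    by (auto simp: V_def)

  \<comment> \<open>The matrix \<open>diag(-h, h)\<close>, in the linear form that \<open>DG\<close>
    prescribes. Its zero entries survive as syntax in \<open>gh\<close>.\<close>
  define a where "a i j = (if i \<noteq> j then Const 0 else if i = 0 then Mult (Const (-1)) h else h)"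
    for i j :: nat
  define gh where "gh = ghost_ode [y, z] a (\<lambda>_. Const 0)"
  define ode' where "ode' = ode @ gh"
  have gh: "gh = [(y, Add (Add (Mult (Mult (Const (-1)) h) (Var y)) (Mult (Const 0) (Var z))) (Const 0)),
      (z, Add (Add (Mult (Const 0) (Var y)) (Mult h (Var z))) (Const 0))]"
    by (simp add: gh_def ghost_ode_def a_def upt_rec)
  have distinct': "distinct (map fst ode')"
    using assms(1) y z ode_V by (auto simp: ode'_def gh)

  \<comment> \<open>The ghosts do not occur in \<open>P i\<close>, so Lie derivatives along
    \<open>ode'\<close> keep their values and the premise \<open>E\<close>, stated for
    \<open>ode\<close>, stays applicable.\<close>
  have lie_P: "term_sem (lie ode' (P i)) \<sigma> = term_sem (P (Suc i)) \<sigma>" for i \<sigma>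
  proof -
    have "ode_vars gh \<inter> term_vars (P i) = {}"
      using y z ode_V vars_P[of i] by (simp add: gh) blast
    then show ?thesis
      by (simp add: ode'_def term_sem_lie_append term_sem_lie_notin P_def)
  qed
  have lie_yz: "term_sem (lie ode' (Var y)) \<sigma> = - term_sem h \<sigma> * \<sigma> y"
    "term_sem (lie ode' (Var z)) \<sigma> = term_sem h \<sigma> * \<sigma> z" for \<sigma>
  proof -
    have "ode_vars ode \<inter> term_vars (Var y) = {}" "ode_vars ode \<inter> term_vars (Var z) = {}"
      using y z ode_V by auto
    then show "term_sem (lie ode' (Var y)) \<sigma> = - term_sem h \<sigma> * \<sigma> y"
      "term_sem (lie ode' (Var z)) \<sigma> = term_sem h \<sigma> * \<sigma> z"
      using z by (auto simp: ode'_def term_sem_lie_append term_sem_lie_notin)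
        (auto simp: term_sem_lie gh of_rat_minus)
  qed
  have sem_s: "term_sem s \<sigma> = (\<Sum>i<N. (term_sem (P i) \<sigma>)\<^sup>2)" for \<sigma>
    by (simp add: s_def term_sem_tsum o_def power2_eq_square interv_sum_list_conv_sum_set_nat
        atLeast0LessThan)
  have sem_h: "term_sem h \<sigma> = (\<Sum>i<N. 2 + (term_sem (g i) \<sigma>)\<^sup>2)" for \<sigma>
    by (simp add: h_def term_sem_tsum o_def power2_eq_square interv_sum_list_conv_sum_set_nat
        atLeast0LessThan)
  have lie_s: "term_sem (lie ode' s) \<sigma> = 2 * (\<Sum>i<N. term_sem (P i) \<sigma> * term_sem (P (Suc i)) \<sigma>)" for \<sigma>
    by (simp add: s_def term_sem_lie_tsum o_def interv_sum_list_conv_sum_set_nat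
        atLeast0LessThan term_sem_lie_Mult lie_P sum_distrib_left algebra_simps)

  \<comment> \<open>Both are shaped for the comparison with \<open>0\<close> in the
    \<open>DI\<close> axioms; the minus sign in \<open>w\<close> turns an upper bound on
    \<open>s y^2\<close> into a \<open>Geq\<close>.\<close>
  define u where "u = Add (Mult (Var y) (Var z)) (Const (-1))"
  define w where "w = Mult (Const (-1)) (Mult s (Mult (Var y) (Var y)))"
  \<comment> \<open>The opposite rates cancel: \<open>(yz)' = -hyz + hyz\<close>.\<close>
  have lie_u: "term_sem (lie ode' u) \<sigma> = 0" for \<sigma>
    by (simp add: u_def term_sem_lie_Add term_sem_lie_Mult term_sem_lie_Const lie_yz)
  have sem_w: "term_sem w \<sigma> = - term_sem s \<sigma> * (\<sigma> y)\<^sup>2" for \<sigma>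
    by (simp add: w_def of_rat_minus power2_eq_square)
  have lie_w: "term_sem (lie ode' w) \<sigma> \<ge> 0" if "fml_sem E \<sigma>" for \<sigma>
  proof -
    have "term_sem (P N) \<sigma> = (\<Sum>j<N. term_sem (g j) \<sigma> * term_sem (P j) \<sigma>)"
      using that by (simp add: E_def term_sem_tsum o_def interv_sum_list_conv_sum_set_nat
          atLeast0LessThan)
    from sum_mult_shift_le[of "\<lambda>i. term_sem (P i) \<sigma>", OF this]
    have "term_sem (lie ode' s) \<sigma> \<le> 2 * (term_sem h \<sigma> * term_sem s \<sigma>)"
      by (simp add: lie_s sem_h sem_s)
    \<comment> \<open>From \<open>y' = -hy\<close> comes \<open>(y^2)' = -2h y^2\<close>, which
      turns \<open>-s (y^2)'\<close> into \<open>2hs y^2\<close>.\<close>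
    moreover have "term_sem (lie ode' w) \<sigma> =
        (2 * (term_sem h \<sigma> * term_sem s \<sigma>) - term_sem (lie ode' s) \<sigma>) * (\<sigma> y)\<^sup>2"
      by (simp add: w_def term_sem_lie_Mult term_sem_lie_Const lie_yz of_rat_minus
          power2_eq_square algebra_simps)
    ultimately show ?thesis by simp
  qed

  define \<Delta> where "\<Delta> = insert (Eq (Var z) (Const 1)) (insert (Eq (Var y) (Const 1)) \<Gamma>)"
  have \<Delta>: "wf_context \<Delta>" "\<Gamma> \<subseteq> \<Delta>"
    using ctx by (auto simp: \<Delta>_def)
  note wf_Q = fo_imp_wf_fml[OF \<open>fo Q\<close>]
  have inv_u: "derivable H \<Delta> (Box (ODE ode' Q) (Eq u (Const 0)))"
  proof (rule derivable_diff_inv[OF base_axiom.DI_Eq])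
    have "derivable H {} (Eq (lie ode' u) (Const 0))"
      by (rule derivable.real_arith) (auto simp: valid_def lie_u)
    then show "derivable H {Q} (Eq (lie ode' u) (Const 0))"
      by (rule derivable_weaken) (auto simp: wf_context_def wf_Q)
    have "derivable H {} (Imp (Eq (Var z) (Const 1)) (Imp (Eq (Var y) (Const 1)) (Eq u (Const 0))))"
      by (rule derivable.real_arith) (auto simp: valid_def u_def of_rat_minus)
    then have "derivable H \<Delta> (Imp (Eq (Var y) (Const 1)) (Eq u (Const 0)))"
      by (rule derivable_mp_theorem) (use \<Delta> in \<open>auto simp: \<Delta>_def intro: derivable_assumption\<close>)
    then have "derivable H \<Delta> (Eq u (Const 0))"
      by (rule derivable_mp) (use \<Delta> in \<open>auto simp: \<Delta>_def intro: derivable_assumption\<close>)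
    then show "derivable H (insert Q \<Delta>) (Eq u (Const 0))"
      by (rule derivable_weaken) (auto simp: \<Delta> wf_Q)
  qed (use \<Delta> distinct' \<open>fo Q\<close> in auto)
  have inv_w: "derivable H \<Delta> (Box (ODE ode' Q) (Geq w (Const 0)))"
  proof (rule derivable_diff_inv[OF base_axiom.DI_Geq])
    \<comment> \<open>The second premise has exactly the context allowed in the step; the first,
      which involves \<open>\<Gamma>\<close>, supplies the initial condition.\<close>
    have E: "derivable H {Q} E" by (rule derivable.premise) (simp add: H_def)
    have "derivable H {} (Imp E (Geq (lie ode' w) (Const 0)))"
      by (rule derivable.real_arith) (auto simp: valid_def lie_w, simp add: E_def)
    then show "derivable H {Q} (Geq (lie ode' w) (Const 0))"
      by (rule derivable_mp_theorem[OF _ E]) (auto simp: wf_context_def wf_Q)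
    have "derivable H (insert Q \<Gamma>) C" by (rule derivable.premise) (simp add: H_def)
    then have C: "derivable H (insert Q \<Delta>) C"
      by (rule derivable_weaken) (use \<Delta> wf_Q in auto)
    \<comment> \<open>\<open>C\<close> makes \<open>s\<close> vanish, so \<open>w = 0\<close>
      initially for any value of \<open>y\<close>.\<close>
    have "derivable H {} (Imp C (Geq w (Const 0)))"
      by (rule derivable.real_arith)
        (auto simp: valid_def C_def fo_conjs fml_sem_conjs sem_w sem_s)
    then show "derivable H (insert Q \<Delta>) (Geq w (Const 0))"
      by (rule derivable_mp_theorem[OF _ C]) (use \<Delta> wf_Q in auto)
  qed (use \<Delta> distinct' \<open>fo Q\<close> in auto)
  have "derivable H {} (Imp (Eq u (Const 0)) (Imp (Geq w (Const 0)) (Eq p (Const 0))))"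
  proof (rule derivable.real_arith)
    have "term_sem p \<sigma> = 0" if "\<sigma> y * \<sigma> z = 1" "term_sem s \<sigma> * (\<sigma> y)\<^sup>2 \<le> 0" for \<sigma>
    proof -
      have "(\<sigma> y)\<^sup>2 > 0" using that(1) by auto
      then have "term_sem s \<sigma> \<le> 0"
        using that(2) by (simp add: mult_le_0_iff)
      \<comment> \<open>\<open>N \<ge> 1\<close> ensures that the square of \<open>P 0\<close>,
        which is \<open>p\<close>, is a summand of \<open>s\<close>.\<close>
      moreover have "(term_sem (P 0) \<sigma>)\<^sup>2 \<le> term_sem s \<sigma>"
        unfolding sem_s using \<open>N \<ge> 1\<close> by (intro member_le_sum) auto
      ultimately have "(term_sem (P 0) \<sigma>)\<^sup>2 \<le> 0" by linarith
      then show ?thesis by (simp add: P_def)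
    qed
    then show "valid (Imp (Eq u (Const 0)) (Imp (Geq w (Const 0)) (Eq p (Const 0))))"
      by (auto simp: valid_def sem_w u_def of_rat_minus)
  qed simp
  then have ghosts: "derivable H \<Delta> (Box (ODE ode' Q) (Eq p (Const 0)))"
    by (rule derivable_box_mono2[OF _ inv_u inv_w]) (use \<Delta> distinct' \<open>fo Q\<close> in auto)

  \<comment> \<open>The inner quantifier comes first: \<open>z\<close> is not free in
    \<open>\<Gamma>\<close> or in the equation for \<open>y\<close>, and afterwards \<open>y\<close>
    is not free in \<open>\<Gamma>\<close>.\<close>
  have "derivable H (insert (Eq (Var y) (Const 1)) \<Gamma>) (Exists z (Box (ODE ode' Q) (Eq p (Const 0))))"
    by (rule derivable_Exists_initial_value)
      (use ghosts z distinct' \<open>fo Q\<close> in \<open>auto simp: ctx \<Delta>_def V_def\<close>)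
  then have ex: "derivable H \<Gamma> (foldr Exists [y, z] (Box (ODE ode' Q) (Eq p (Const 0))))"
    using derivable_Exists_initial_value[of H y 1 \<Gamma>] y distinct' \<open>fo Q\<close>
    by (auto simp: ctx V_def)
  have "derivable H \<Gamma> (Iff (Box (ODE ode Q) (Eq p (Const 0)))
      (foldr Exists [y, z] (Box (ODE ode' Q) (Eq p (Const 0)))))"
  proof (rule derivable_weaken[OF derivable.axiom])
    show "base_axiom (Iff (Box (ODE ode Q) (Eq p (Const 0)))
        (foldr Exists [y, z] (Box (ODE ode' Q) (Eq p (Const 0)))))"
      unfolding ode'_def gh_def
    proof (rule base_axiom.DG)
      show "distinct [y, z]" using z by auto
      show "set [y, z] \<inter> all_vars (Box (ODE ode Q) (Eq p (Const 0))) = {}"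
        using y z unfolding V_def by auto
      show "\<forall>i<length [y, z]. \<forall>j<length [y, z]. term_vars (a i j) \<inter> set [y, z] = {}"
        using vars_h ode_V y z by (auto simp: a_def)
    qed simp
  qed (use assms(1,3) distinct' ctx in auto)
  then have "derivable H \<Gamma> (Box (ODE ode Q) (Eq p (Const 0)))"
    by (rule derivable_iff_right_to_left[OF _ ex])
      (use assms(1,3) distinct' ctx in auto)
  then show ?thesis
    unfolding H_def C_def E_def P_def .
qed

end
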